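(* Let $p$ be a prime, let $k\geq 1$ be an integer, and let $S\subset\mathbb{Z}/p^k\mathbb{Z}$ be a primitive formal-dual set. Then $k$ is even and $|S|=p^{k/2}$.
   Context: Let $n\ge 1$ and $\zeta_n = e^{2\pi i/n}$. For $S\subset\mathbb{Z}/n\mathbb{Z}$, the weight enumerator of $S$ is $\nu_S\colon \mathbb{Z}/n\mathbb{Z}\to\mathbb{N}_0$, $\nu_S(y)=\#\{(v,w)\in S\times S : v-w=y\}$. Two nonempty subsets $S,T\subset \mathbb{Z}/n\mathbb{Z}$ are formally-dual to each other if $\frac{|S|^2}{|T|}\nu_T(y)=\sum_{v\in\mathbb{Z}/n\mathbb{Z}}\nu_S(v)\zeta_n^{vy}$ for every $y\in\mathbb{Z}/n\mathbb{Z}$ (this relation is symmetric in $S$ and $T$). A set $S\subset\mathbb{Z}/n\mathbb{Z}$ is formal-dual if there is a $T\subset\mathbb{Z}/n\mathbb{Z}$ such that $S$ and $T$ are formally-dual to each other. A pair of formally-dual subsets $S,T\subset\mathbb{Z}/n\mathbb{Z}$ is primitive if neither $S$ nor $T$ is contained in a coset of a proper subgroup of $\mathbb{Z}/n\mathbb{Z}$. A formal-dual subset $S$ is primitive if there is some $T\subset\mathbb{Z}/n\mathbb{Z}$ such that $S$ and $T$ form a primitive pair. *)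

theory Defs
  imports Complex_Main "HOL-Computational_Algebra.Primes" "HOL-Algebra.Elementary_Groups"
begin

text \<open>
  The group of integers modulo n (n at least 1) is the library's
  \<^term>\<open>integer_mod_group n\<close>: its carrier is the set {0..<n} of integer representatives,
  so its subsets are sets of type \<^typ>\<open>int set\<close> contained in that carrier.
\<close>

definition zeta :: "nat \<Rightarrow> complex" where
  "zeta n = exp (2 * complex_of_real pi * \<i> / of_nat n)"

text \<open>The lemma after this definition identifies the condition with the difference taken in
  the group.\<close>

definition weight_enumerator :: "nat \<Rightarrow> int set \<Rightarrow> int \<Rightarrow> nat" where
  "weight_enumerator n S y = card {(v, w) \<in> S \<times> S. (v - w) mod int n = y}"

lemma integer_mod_group_diff:
  assumes "w \<in> carrier (integer_mod_group n)"
  shows "v \<otimes>\<^bsub>integer_mod_group n\<^esub> inv\<^bsub>integer_mod_group n\<^esub> w = (v - w) mod int n"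
  using assms by (simp add: mod_simps)

definition formally_dual :: "nat \<Rightarrow> int set \<Rightarrow> int set \<Rightarrow> bool" where
  "formally_dual n S T \<longleftrightarrow>
     S \<subseteq> carrier (integer_mod_group n) \<and> S \<noteq> {} \<and>
     T \<subseteq> carrier (integer_mod_group n) \<and> T \<noteq> {} \<and>
     (\<forall>y \<in> carrier (integer_mod_group n).
        of_nat (card S) ^ 2 / of_nat (card T) * of_nat (weight_enumerator n T y) =
        (\<Sum>v \<in> carrier (integer_mod_group n).
           of_nat (weight_enumerator n S v) * zeta n powi (v * y)))"

definition in_proper_coset :: "nat \<Rightarrow> int set \<Rightarrow> bool" where
  "in_proper_coset n S \<longleftrightarrow>
     (\<exists>H. \<exists>a \<in> carrier (integer_mod_group n).
        subgroup H (integer_mod_group n) \<and> H \<noteq> carrier (integer_mod_group n) \<and>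
        S \<subseteq> H #>\<^bsub>integer_mod_group n\<^esub> a)"

definition primitive_pair :: "nat \<Rightarrow> int set \<Rightarrow> int set \<Rightarrow> bool" where
  "primitive_pair n S T \<longleftrightarrow>
     formally_dual n S T \<and> \<not> in_proper_coset n S \<and> \<not> in_proper_coset n T"

definition primitive_formal_dual :: "nat \<Rightarrow> int set \<Rightarrow> bool" where
  "primitive_formal_dual n S \<longleftrightarrow> (\<exists>T. primitive_pair n S T)"

end

theory Submission
  imports Defs "HOL-Computational_Algebra.Polynomial_Factorial" "HOL-Library.Real_Mod"
begin

text \<open>
  Write n = p^k. Fourier inversion gives |S| |T| = n, so |S| and |T| are powers of p.
  The n-th cyclotomic polynomial is irreducible (Eisenstein at X + 1), hence an integer
  polynomial that vanishes at one primitive n-th root of unity vanishes at all of them.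
  Applied to the polynomial with coefficients \<nu>_S, this shows that \<nu>_T is either zero
  on all units modulo n or nonzero on all of them, and primitivity excludes the former;
  the same holds for \<nu>_S. Summing \<nu>_S over \<int>/n\<int> then gives
  |S|^2 \<ge> |S| + p^k - p^(k-1) > p^(k-1), i.e. |S| \<ge> p^(k/2), and likewise for T.
  As |S| |T| = p^k, both are equal to p^(k/2).
\<close>

section \<open>Eisenstein's criterion\<close>

text \<open>If \<open>p\<close> did not divide the binomial coefficient, the absorption identity
  would force \<open>p ^ k\<close> to divide \<open>j\<close>, which is positive and
  smaller.\<close>

lemma prime_dvd_choose_prime_power:
  fixes p :: nat
  assumes "prime p" "0 < j" "j < p ^ k"
  shows "p dvd (p ^ k choose j)"
proof (rule ccontr)
  assume "\<not> p dvd (p ^ k choose j)"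
  with \<open>prime p\<close> have "coprime (p ^ k) (p ^ k choose j)"
    using coprime_power_left_iff prime_imp_coprime by blast
  moreover have "j * (p ^ k choose j) = p ^ k * ((p ^ k - 1) choose (j - 1))"
    by (rule times_binomial_minus1_eq) (use assms in simp)
  ultimately have "p ^ k dvd j"
    by (metis coprime_dvd_mult_left_iff dvd_triv_left)
  with assms show False
    using nat_dvd_not_less by blast
qed

text \<open>If \<open>p\<close> did not divide the constant term of \<open>G\<close>, the
  coefficients of \<open>Q\<close> could be shown divisible by \<open>p\<close> one after the other
  from the bottom. As \<open>G\<close> is not constant, this reaches the leading coefficient of
  \<open>Q\<close>, so \<open>p\<close> would divide 1.\<close>

lemma eisenstein_factor:
  fixes G Q :: "'a :: idom poly"
  assumes p: "prime_elem p" and lc: "lead_coeff (G * Q) = 1"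
    and low: "\<And>i. i < degree (G * Q) \<Longrightarrow> p dvd coeff (G * Q) i"
    and deg: "degree G > 0"
  shows "p dvd coeff G 0"
proof (rule ccontr)
  assume G0: "\<not> p dvd coeff G 0"
  have Q: "p dvd coeff Q i" if "i < degree (G * Q)" for i
    using that
  proof (induction i rule: less_induct)
    case (less i)
    have "coeff (G * Q) i = (\<Sum>j\<le>i. coeff G j * coeff Q (i - j))"
      by (rule coeff_mult)
    also have "\<dots> = coeff G 0 * coeff Q i + (\<Sum>j\<in>{1..i}. coeff G j * coeff Q (i - j))"
    proof -
      have "{..i} = insert 0 {1..i}"
        by auto
      then show ?thesis
        by simp
    qed
    finally have "coeff G 0 * coeff Q i
        = coeff (G * Q) i - (\<Sum>j\<in>{1..i}. coeff G j * coeff Q (i - j))"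
      by simp
    also have "p dvd \<dots>"
      using less low by (intro dvd_diff dvd_sum dvd_mult) auto
    finally show ?case
      using p G0 prime_elem_dvd_multD by blast
  qed
  have "G * Q \<noteq> 0"
    using lc by auto
  then have "degree Q < degree (G * Q)"
    using deg by (auto simp: degree_mult_eq)
  then have "p dvd lead_coeff (G * Q)"
    by (metis Q lead_coeff_mult dvd_mult)
  with lc p show False
    by (simp add: prime_elem_def)
qed

lemma eisenstein_irreducible:
  fixes f :: "'a :: idom poly"
  assumes p: "prime_elem p" and lc: "lead_coeff f = 1" and deg: "degree f > 0"
    and low: "\<And>i. i < degree f \<Longrightarrow> p dvd coeff f i"
    and "\<not> p\<^sup>2 dvd coeff f 0"
  shows "irreducible f"
proof (rule irreducibleI)
  show "f \<noteq> 0"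
    using lc by auto
  show "\<not> f dvd 1"
    using deg by (auto simp: is_unit_poly_iff)
  fix G Q assume f: "f = G * Q"
  \<comment> \<open>As \<open>f\<close> is monic, the leading coefficient of any factor is a unit,
    and a constant factor is its own leading coefficient.\<close>
  have unit: "a dvd 1" if "degree a = 0" "f = a * b" for a b
    using that lc by (metis degree_eq_zeroE dvd_triv_left is_unit_const_poly_iff lead_coeff_mult lead_coeff_pCons(2))
  show "G dvd 1 \<or> Q dvd 1"
  proof (rule ccontr)
    assume "\<not> (G dvd 1 \<or> Q dvd 1)"
    then have "degree G > 0" "degree Q > 0"
      using unit f by (metis bot_nat_0.not_eq_extremum mult.commute)+
    then have "p dvd coeff G 0" "p dvd coeff Q 0"
      using eisenstein_factor[of p G Q] eisenstein_factor[of p Q G] p lc low f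
      by (simp_all add: mult.commute)
    then have "p\<^sup>2 dvd coeff f 0"
      by (simp add: f coeff_mult_0 power2_eq_square mult_dvd_mono)
    with assms show False
      by simp
  qed
qed

text \<open>Substituting \<open>X + c\<close> is a ring automorphism with inverse
  \<open>X - c\<close>, so units and factorizations correspond.\<close>

lemma irreducible_pcompose_shift:
  fixes f :: "'a :: idom poly"
  assumes "irreducible (pcompose f [:c, 1:])"
  shows "irreducible f"
proof -
  have inv: "pcompose (pcompose g [:c, 1:]) [:- c, 1:] = g" for g
    by (simp add: pcompose_pCons flip: pcompose_assoc)
  have unit: "g dvd 1" if "pcompose g [:c, 1:] dvd 1" for g
  proof -
    from that obtain h where "1 = pcompose g [:c, 1:] * h"
      by (elim dvdE)
    then have "1 = pcompose (pcompose g [:c, 1:]) [:- c, 1:] * pcompose h [:- c, 1:]"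
      by (metis pcompose_1 pcompose_mult)
    then show ?thesis
      by (metis inv dvd_triv_left)
  qed
  show ?thesis
  proof (rule irreducibleI)
    show "f \<noteq> 0"
      using assms by auto
    show "\<not> f dvd 1"
      using assms by (auto simp: is_unit_poly_iff irreducible_def)
    show "a dvd 1 \<or> b dvd 1" if "f = a * b" for a b
      using assms unit that by (metis irreducibleD pcompose_mult)
  qed
qed

section \<open>Cyclotomic polynomials of prime power order\<close>

text \<open>For m = p^(k-1) this is the p^k-th cyclotomic polynomial.\<close>

definition prime_power_cyclotomic :: "nat \<Rightarrow> nat \<Rightarrow> int poly" where
  "prime_power_cyclotomic p m = (\<Sum>i<p. monom 1 (i * m))"

text \<open>A telescoping geometric sum in \<open>X ^ m\<close>. Degree, leading coefficient, the
  shift to \<open>X + 1\<close> and the roots are all read off from it.\<close>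

lemma prime_power_cyclotomic_mult:
  "prime_power_cyclotomic p m * (monom 1 m - 1) = monom 1 (p * m) - 1"
proof -
  have "(\<Sum>i<n. monom 1 (i * m)) * (monom 1 m - 1) = monom (1::int) (n * m) - 1" for n
    by (induction n) (simp_all add: algebra_simps mult_monom)
  then show ?thesis
    by (simp add: prime_power_cyclotomic_def)
qed

lemma degree_prime_power_cyclotomic:
  assumes "p > 0" "m > 0"
  shows "degree (prime_power_cyclotomic p m) = (p - 1) * m"
    and "lead_coeff (prime_power_cyclotomic p m) = 1"
proof -
  let ?P = "prime_power_cyclotomic p m"
  have nz: "monom 1 n - 1 \<noteq> (0::int poly)" and dg: "degree (monom 1 n - 1 :: int poly) = n"
    and lc: "lead_coeff (monom 1 n - 1 :: int poly) = 1" if "n > 0" for n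
  proof -
    have "monom 1 n - 1 = monom 1 n + (-1 :: int poly)" by simp
    moreover have "degree (monom 1 n + (-1) :: int poly) = n"
      using that by (subst degree_add_eq_left) (auto simp: degree_monom_eq)
    ultimately show d: "degree (monom 1 n - 1 :: int poly) = n" by simp
    then show "monom 1 n - 1 \<noteq> (0::int poly)" using that by auto
    show "lead_coeff (monom 1 n - 1 :: int poly) = 1" using that by (subst d) simp
  qed
  have P0: "?P \<noteq> 0"
    using prime_power_cyclotomic_mult[of p m] nz[of "p * m"] assms by auto
  have "degree ?P + m = p * m"
    using prime_power_cyclotomic_mult[of p m] dg[of m] dg[of "p * m"] assms
    by (metis P0 degree_mult_eq nz nat_0_less_mult_iff)
  then show "degree ?P = (p - 1) * m"
    by (simp add: diff_mult_distrib)
  show "lead_coeff ?P = 1"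
    using prime_power_cyclotomic_mult[of p m] lc[of m] lc[of "p * m"] assms
    by (metis lead_coeff_mult mult.right_neutral nat_0_less_mult_iff)
qed

text \<open>Modulo \<open>p\<close>, \<open>(X + 1) ^ (p ^ l)\<close> is
  \<open>X ^ (p ^ l) + 1\<close>. The shifted polynomial \<open>E\<close> therefore satisfies
  \<open>E * X ^ m = X ^ (p * m)\<close> modulo \<open>p\<close>, while its constant term is exactly
  \<open>p\<close>; Eisenstein's criterion applies.\<close>

lemma irreducible_prime_power_cyclotomic:
  assumes p: "prime p"
  shows "irreducible (prime_power_cyclotomic p (p ^ k))"
proof (rule irreducible_pcompose_shift)
  define m where "m = p ^ k"
  let ?P = "prime_power_cyclotomic p (p ^ k)"
  define E where "E = pcompose ?P [:1, 1:]"
  have p1: "p > 1"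
    using p prime_gt_1_nat by blast
  then have m: "m > 0"
    by (simp add: m_def)
  have degE: "degree E = (p - 1) * m"
    using degree_prime_power_cyclotomic(1)[of p m] p1 m by (simp add: E_def m_def degree_pcompose)
  have lcE: "lead_coeff E = 1"
    using degree_prime_power_cyclotomic(2)[of p m] p1 m
    unfolding E_def m_def by (subst lead_coeff_comp) auto
  \<comment> \<open>For \<open>n > 0\<close> these are the inner terms of the binomial expansion;
    for \<open>n = p ^ l\<close> they all vanish modulo \<open>p\<close>.\<close>
  define R where "R n = [:1, 1:] ^ n - 1 - monom (1::int) n" for n
  have R: "int p dvd coeff (R (p ^ l)) i" for l i
  proof -
    have "coeff ([:1, 1:] ^ n :: int poly) i = int (n choose i)" for n
    proof (cases "i \<le> n")
      case True
      then show ?thesis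
        by (simp add: coeff_linear_poly_power)
    next
      case False
      have "degree ([:1, 1:] ^ n :: int poly) \<le> 1 * n"
        using degree_power_le[of "[:1, 1:] :: int poly" n] by simp
      with False show ?thesis
        by (simp add: coeff_eq_0 binomial_eq_0)
    qed
    then show ?thesis
      using prime_dvd_choose_prime_power[OF p, of i l] p1
      by (cases "i = 0"; cases "i = p ^ l"; cases "i < p ^ l")
        (auto simp: R_def binomial_eq_0)
  qed
  have eq: "E * (R m + monom 1 m) = R (p * m) + monom 1 (p * m)"
  proof -
    have mon: "pcompose (monom 1 n - 1) [:1, 1:] = R n + monom (1::int) n" for n
    proof -
      have "pcompose (monom 1 n) q = (q ^ n :: int poly)" for q
        by (induction n) (simp_all add: monom_Suc monom_0 pcompose_pCons)
      then show ?thesis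
        by (simp add: R_def pcompose_diff pcompose_1)
    qed
    show ?thesis
      using arg_cong[OF prime_power_cyclotomic_mult[of p m], of "\<lambda>f. pcompose f [:1, 1:]"]
      by (simp add: pcompose_mult mon E_def m_def)
  qed
  \<comment> \<open>Coefficient \<open>i\<close> of \<open>E\<close> is read at position
    \<open>i + m\<close>. Since \<open>i < (p - 1) * m\<close>, this lies below
    \<open>p * m\<close>, so the top monomial contributes nothing and only multiples of
    \<open>p\<close> remain.\<close>
  have low: "int p dvd coeff E i" if "i < degree E" for i
  proof -
    have "coeff E i = coeff (E * monom 1 m) (i + m)"
      by (subst mult.commute) (simp add: coeff_monom_mult)
    also have "\<dots> = coeff (R (p * m) - E * R m + monom 1 (p * m)) (i + m)"
    proof -
      have "E * monom 1 m = R (p * m) - E * R m + monom 1 (p * m)"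
        using eq by (simp add: algebra_simps)
      then show ?thesis
        by simp
    qed
    also have "\<dots> = coeff (R (p ^ Suc k)) (i + m) - (\<Sum>j\<le>i + m. coeff E j * coeff (R (p ^ k)) (i + m - j))"
      using that degE by (auto simp: coeff_mult m_def diff_mult_distrib)
    also have "int p dvd \<dots>"
      by (intro dvd_diff dvd_sum dvd_mult R)
    finally show ?thesis .
  qed
  \<comment> \<open>The constant term after the shift is the value at 1, where each of the
    \<open>p\<close> monomials equals 1.\<close>
  have "coeff E 0 = int p"
    by (simp add: E_def prime_power_cyclotomic_def poly_sum poly_monom)
  moreover have "\<not> (int p)\<^sup>2 dvd int p"
  proof
    assume "(int p)\<^sup>2 dvd int p"
    then have "(int p)\<^sup>2 \<le> int p" using p1 by (intro zdvd_imp_le) auto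
    then show False using p1 by (simp add: power2_eq_square)
  qed
  ultimately show "irreducible (pcompose ?P [:1, 1:])"
    using low lcE degE p1 m p unfolding E_def[symmetric]
    by (intro eisenstein_irreducible[of "int p"]) auto
qed

section \<open>Integer polynomials at complex points\<close>

text \<open>The coefficients stay in \<open>int\<close>, so that divisibility and irreducibility
  refer to integer polynomials although the points are complex.\<close>

definition eval_int :: "int poly \<Rightarrow> complex \<Rightarrow> complex" where
  "eval_int f z = poly (map_poly of_int f) z"

lemma eval_int_0 [simp]: "eval_int 0 z = 0"
  by (simp add: eval_int_def)

lemma eval_int_pCons [simp]: "eval_int (pCons c f) z = of_int c + z * eval_int f z"
  by (simp add: eval_int_def map_poly_pCons)

lemma eval_int_1 [simp]: "eval_int 1 z = 1"
  by (simp add: eval_int_def)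

lemma eval_int_add [simp]: "eval_int (f + g) z = eval_int f z + eval_int g z"
  by (induction f g rule: poly_induct2) (simp_all add: algebra_simps)

lemma eval_int_smult [simp]: "eval_int (smult c f) z = of_int c * eval_int f z"
  by (induction f) (simp_all add: algebra_simps)

lemma eval_int_diff [simp]: "eval_int (f - g) z = eval_int f z - eval_int g z"
  using eval_int_add[of "f - g" g z] by simp

lemma eval_int_mult [simp]: "eval_int (f * g) z = eval_int f z * eval_int g z"
  by (induction f) (simp_all add: algebra_simps)

lemma eval_int_monom [simp]: "eval_int (monom c n) z = of_int c * z ^ n"
  by (induction n) (simp_all add: monom_Suc monom_0)

lemma eval_int_sum [simp]: "eval_int (\<Sum>i\<in>A. f i) z = (\<Sum>i\<in>A. eval_int (f i) z)"
  by (induction A rule: infinite_finite_induct) simp_all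

lemma eval_int_prime_power_cyclotomic_eq_0:
  assumes "z ^ (p * m) = 1" "z ^ m \<noteq> 1"
  shows "eval_int (prime_power_cyclotomic p m) z = 0"
  using arg_cong[OF prime_power_cyclotomic_mult[of p m], of "\<lambda>f. eval_int f z"] assms by simp

text \<open>Pseudo-division replaces division over the rationals, and an irreducible integer
  polynomial is prime. The pseudo-remainder of \<open>g\<close> by \<open>f\<close> vanishes at
  \<open>z\<close> and is too small to be nonzero, so \<open>f\<close> divides a constant multiple
  of \<open>g\<close>, hence \<open>g\<close>.\<close>

lemma dvd_if_irreducible_common_root:
  assumes "irreducible f" and lc: "lead_coeff f = 1" and "eval_int f z = 0" "eval_int g z = 0"
  shows "f dvd g"
proof -
  have prime: "prime_elem f"
    using \<open>irreducible f\<close> by (rule irreducible_imp_prime_elem)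
  \<comment> \<open>Descent on the degree: the pseudo-remainder of \<open>f\<close> by
    \<open>h\<close> again vanishes at \<open>z\<close>, so it is 0. Then the prime \<open>f\<close>
    divides \<open>h * q\<close>, hence \<open>q\<close> for degree reasons, which makes
    \<open>h\<close> a constant with a root.\<close>
  have least: "h = 0" if "eval_int h z = 0" "degree h < degree f" for h
    using that
  proof (induction "degree h" arbitrary: h rule: less_induct)
    case less
    show ?case
    proof (rule ccontr)
      assume "h \<noteq> 0"
      obtain a q where a: "a \<noteq> 0" and fq: "smult a f = h * q + pseudo_mod f h"
        using pseudo_mod(1)[OF \<open>h \<noteq> 0\<close>] by blast
      have r: "pseudo_mod f h = 0 \<or> degree (pseudo_mod f h) < degree h"
        using pseudo_mod(2)[OF \<open>h \<noteq> 0\<close>] by blast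
      have "eval_int (pseudo_mod f h) z = 0"
        using arg_cong[OF fq, of "\<lambda>f. eval_int f z"] assms less.prems by simp
      then have "pseudo_mod f h = 0"
        using r less by (meson less_trans)
      with fq have eq: "smult a f = h * q"
        by simp
      have nz: "f \<noteq> 0" "q \<noteq> 0"
        using lc eq a by auto
      have "f dvd h * q"
        unfolding eq[symmetric] by (rule dvd_smult) simp
      then have "f dvd h \<or> f dvd q"
        by (rule prime_elem_dvd_multD[OF prime])
      moreover have "\<not> f dvd h"
        using less.prems \<open>h \<noteq> 0\<close> dvd_imp_degree_le[of f h] by linarith
      ultimately have "degree f \<le> degree q"
        using nz dvd_imp_degree_le by blast
      moreover have "degree f = degree h + degree q"
        using arg_cong[OF eq, of degree] a \<open>h \<noteq> 0\<close> nz by (simp add: degree_mult_eq)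
      ultimately have "degree h = 0"
        by simp
      then obtain c where "h = [:c:]"
        by (rule degree_eq_zeroE)
      with less.prems \<open>h \<noteq> 0\<close> show False
        by simp
    qed
  qed
  have "f \<noteq> 0"
    using lc by auto
  obtain a q where a: "a \<noteq> 0" and gq: "smult a g = f * q + pseudo_mod g f"
    using pseudo_mod(1)[OF \<open>f \<noteq> 0\<close>] by blast
  have r: "pseudo_mod g f = 0 \<or> degree (pseudo_mod g f) < degree f"
    using pseudo_mod(2)[OF \<open>f \<noteq> 0\<close>] by blast
  have "eval_int (pseudo_mod g f) z = 0"
    using arg_cong[OF gq, of "\<lambda>f. eval_int f z"] assms by simp
  then have "pseudo_mod g f = 0"
    using r least by blast
  with gq have "f dvd [:a:] * g"
    by simp
  then have "f dvd [:a:] \<or> f dvd g"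
    by (rule prime_elem_dvd_multD[OF prime])
  moreover have "\<not> f dvd [:a:]"
  proof
    assume "f dvd [:a:]"
    then obtain h where "[:a:] = f * h"
      by (elim dvdE)
    then have "eval_int [:a:] z = 0"
      using assms by simp
    with a show False
      by simp
  qed
  ultimately show ?thesis
    by blast
qed

text \<open>The hypotheses say that \<open>z\<close> and \<open>w\<close> have exact order
  \<open>p ^ Suc k\<close>. Both are roots of the same irreducible polynomial, which divides
  \<open>f\<close> because of \<open>z\<close>. This does the work of Galois conjugation.\<close>

lemma eval_int_eq_0_conjugate:
  fixes z w :: complex
  assumes p: "prime p" and z: "z ^ (p ^ Suc k) = 1" "z ^ (p ^ k) \<noteq> 1"
    and w: "w ^ (p ^ Suc k) = 1" "w ^ (p ^ k) \<noteq> 1"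
    and f: "eval_int f z = 0"
  shows "eval_int f w = 0"
proof -
  let ?P = "prime_power_cyclotomic p (p ^ k)"
  have "p > 0"
    using p prime_gt_0_nat by blast
  then have "?P dvd f"
    using dvd_if_irreducible_common_root[of ?P z f] irreducible_prime_power_cyclotomic[OF p, of k]
      eval_int_prime_power_cyclotomic_eq_0[of z p "p ^ k"] degree_prime_power_cyclotomic(2)[of p "p ^ k"]
      z f by simp
  then obtain g where "f = ?P * g"
    by (elim dvdE)
  moreover have "eval_int ?P w = 0"
    using w by (simp add: eval_int_prime_power_cyclotomic_eq_0)
  ultimately show ?thesis
    by simp
qed

section \<open>Characters of the cyclic group\<close>

lemma zeta_powi_eq_1_iff:
  assumes "n > 0"
  shows "zeta n powi m = 1 \<longleftrightarrow> int n dvd m"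
proof -
  have "zeta n = cis (2 * pi / n)"
    by (simp add: zeta_def cis_conv_exp mult_ac)
  then have "zeta n powi m = cis (of_int m * (2 * pi / n))"
    by (simp add: cis_power_int)
  also have "\<dots> = 1 \<longleftrightarrow> (\<exists>j. of_int m * (2 * pi / n) = of_int j * (2 * pi))"
    by (rule cis_eq_1_iff)
  also have "\<dots> \<longleftrightarrow> (\<exists>j. m = int n * j)"
  proof (rule ex_cong1)
    fix j
    have "of_int m * (2 * pi / n) = of_int j * (2 * pi) \<longleftrightarrow> real_of_int m = real_of_int (int n * j)"
      using assms by (simp add: field_simps)
    then show "of_int m * (2 * pi / n) = of_int j * (2 * pi) \<longleftrightarrow> m = int n * j"
      by (simp only: of_int_eq_iff)
  qed
  finally show ?thesis
    by (simp add: dvd_def)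
qed

lemma zeta_neq_0 [simp]: "zeta n \<noteq> 0"
  by (simp add: zeta_def)

lemma sum_int_interval: "(\<Sum>v\<in>{0..<int n}. g v) = (\<Sum>v<n. g (int v))"
  by (rule sum.reindex_bij_witness[where i = int and j = nat]) auto

text \<open>Orthogonality of characters, as a geometric sum whose ratio is an \<open>n\<close>-th
  root of unity.\<close>

lemma sum_zeta_powi:
  assumes "n > 0"
  shows "(\<Sum>y\<in>{0..<int n}. zeta n powi (m * y)) = (if int n dvd m then of_nat n else 0)"
proof -
  let ?z = "zeta n powi m"
  have "(\<Sum>y\<in>{0..<int n}. zeta n powi (m * y)) = (\<Sum>y<n. ?z ^ y)"
    by (simp add: sum_int_interval power_int_mult)
  moreover have "?z ^ n = 1"
    using zeta_powi_eq_1_iff[OF assms, of "m * int n"] by (simp add: power_int_mult)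
  ultimately show ?thesis
    using zeta_powi_eq_1_iff[OF assms, of m] by (simp add: sum_gp_strict)
qed

section \<open>Weight enumerators and Fourier inversion\<close>

text \<open>The pairs in \<open>S \<times> S\<close> are partitioned by their difference modulo
  \<open>n\<close>.\<close>

lemma sum_weight_enumerator:
  assumes "n > 0" "finite S"
  shows "(\<Sum>v\<in>{0..<int n}. weight_enumerator n S v) = (card S)\<^sup>2"
proof -
  have "(\<Sum>v\<in>{0..<int n}. weight_enumerator n S v)
      = (\<Sum>v\<in>{0..<int n}. \<Sum>x\<in>{x \<in> S \<times> S. (fst x - snd x) mod int n = v}. 1)"
    by (intro sum.cong) (auto simp: weight_enumerator_def case_prod_unfold intro!: arg_cong[of _ _ card])
  also have "\<dots> = (\<Sum>x\<in>S \<times> S. 1)"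
    using assms by (intro sum.group) auto
  finally show ?thesis
    by (simp add: card_cartesian_product power2_eq_square)
qed

text \<open>Elements of \<open>S\<close> are reduced representatives, so only diagonal pairs have
  difference 0 modulo \<open>n\<close>.\<close>

lemma weight_enumerator_0:
  assumes "S \<subseteq> {0..<int n}"
  shows "weight_enumerator n S 0 = card S"
proof -
  have "x = y" if "x \<in> S" "y \<in> S" "int n dvd x - y" for x y
  proof -
    have "x mod int n = y mod int n"
      using that(3) by (simp add: mod_eq_dvd_iff)
    then show ?thesis
      using that assms by (metis atLeastLessThan_iff mod_pos_pos_trivial subsetD)
  qed
  then have "{(v, w) \<in> S \<times> S. (v - w) mod int n = 0} = (\<lambda>x. (x, x)) ` S"
    by (auto simp: mod_eq_0_iff_dvd)
  then show ?thesis
    by (simp add: weight_enumerator_def card_image inj_on_def)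
qed

text \<open>After inserting the duality relation and swapping sums, orthogonality keeps only
  \<open>v = w\<close>. This expresses the weights of \<open>S\<close> through those of
  \<open>T\<close>, so that the argument for \<open>T\<close> can be repeated for
  \<open>S\<close>.\<close>

lemma formally_dual_inversion:
  assumes fd: "formally_dual n S T" and n: "n > 0" and w: "w \<in> {0..<int n}"
  shows "of_nat (card S) ^ 2 / of_nat (card T) *
      (\<Sum>y\<in>{0..<int n}. of_nat (weight_enumerator n T y) * zeta n powi (- w * y))
    = of_nat n * of_nat (weight_enumerator n S w)"
proof -
  let ?C = "{0..<int n}" and ?c = "of_nat (card S) ^ 2 / of_nat (card T) :: complex"
  have dual: "?c * of_nat (weight_enumerator n T y)
      = (\<Sum>v\<in>?C. of_nat (weight_enumerator n S v) * zeta n powi (v * y))" if "y \<in> ?C" for y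
    using fd n that by (simp add: formally_dual_def carrier_integer_mod_group)
  have "?c * (\<Sum>y\<in>?C. of_nat (weight_enumerator n T y) * zeta n powi (- w * y))
      = (\<Sum>y\<in>?C. (?c * of_nat (weight_enumerator n T y)) * zeta n powi (- w * y))"
    by (simp add: sum_distrib_left mult.assoc)
  also have "\<dots> = (\<Sum>y\<in>?C. \<Sum>v\<in>?C. of_nat (weight_enumerator n S v) * zeta n powi ((v - w) * y))"
  proof (intro sum.cong refl)
    fix y assume "y \<in> ?C"
    have "zeta n powi ((v - w) * y) = zeta n powi (v * y) * zeta n powi (- w * y)" for v
      by (simp add: left_diff_distrib flip: power_int_add)
    then show "?c * of_nat (weight_enumerator n T y) * zeta n powi (- w * y)
        = (\<Sum>v\<in>?C. of_nat (weight_enumerator n S v) * zeta n powi ((v - w) * y))"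
      unfolding dual[OF \<open>y \<in> ?C\<close>] by (simp only: sum_distrib_right mult.assoc)
  qed
  also have "\<dots> = (\<Sum>v\<in>?C. of_nat (weight_enumerator n S v) * (\<Sum>y\<in>?C. zeta n powi ((v - w) * y)))"
    by (subst sum.swap) (simp add: sum_distrib_left)
  also have "\<dots> = (\<Sum>v\<in>?C. if v = w then of_nat (weight_enumerator n S v) * of_nat n else 0)"
  proof (intro sum.cong refl)
    fix v assume "v \<in> ?C"
    then have "int n dvd v - w \<longleftrightarrow> v = w"
      using w by (auto simp flip: mod_eq_dvd_iff)
    then show "of_nat (weight_enumerator n S v) * (\<Sum>y\<in>?C. zeta n powi ((v - w) * y))
        = (if v = w then of_nat (weight_enumerator n S v) * of_nat n else 0)"
      by (simp add: sum_zeta_powi[OF n])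
  qed
  finally show ?thesis
    using w by (simp add: mult.commute)
qed

lemma formally_dual_subset:
  assumes "formally_dual n S T" "n > 0"
  shows "S \<subseteq> {0..<int n}" "T \<subseteq> {0..<int n}" "S \<noteq> {}" "T \<noteq> {}"
  using assms by (simp_all add: formally_dual_def carrier_integer_mod_group)

text \<open>Inversion at \<open>w = 0\<close>: the weights of \<open>T\<close> sum to its squared
  cardinality and the weight of \<open>S\<close> at 0 is \<open>card S\<close>, which gives
  \<open>(card S)\<^sup>2 * card T = n * card S\<close>.\<close>

lemma formally_dual_card:
  assumes fd: "formally_dual n S T" and n: "n > 0"
  shows "card S * card T = n"
proof -
  note sub = formally_dual_subset[OF fd n]
  have fin: "finite S" "finite T"
    using sub finite_subset by blast+
  then have pos: "card S > 0" "card T > 0"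
    using sub by (simp_all add: card_gt_0_iff)
  have "(of_nat (card S) ^ 2 / of_nat (card T) * of_nat ((card T)\<^sup>2) :: complex) = of_nat n * of_nat (card S)"
    using formally_dual_inversion[OF fd n, of 0] n sub
    by (simp add: weight_enumerator_0 flip: of_nat_sum sum_weight_enumerator[OF n fin(2)])
  then have "(of_nat (card S * (card S * card T)) :: complex) = of_nat (card S * n)"
    using pos by (simp add: power2_eq_square field_simps)
  then have "card S * (card S * card T) = card S * n"
    by (simp only: of_nat_eq_iff)
  then show ?thesis
    using pos by simp
qed

text \<open>The sums are the values at \<open>zeta powi a\<close> and \<open>zeta powi b\<close> of
  one integer polynomial with coefficients \<open>g\<close>. Exponents prime to \<open>p\<close>
  give roots of unity of exact order \<open>p ^ Suc k\<close>.\<close>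

lemma zeta_sum_eq_0_conjugate:
  fixes g :: "int \<Rightarrow> nat"
  assumes p: "prime p" and ab: "\<not> int p dvd a" "\<not> int p dvd b"
    and "(\<Sum>v\<in>{0..<int n}. of_nat (g v) * zeta (p ^ Suc k) powi (a * v)) = 0"
  shows "(\<Sum>v\<in>{0..<int n}. of_nat (g v) * zeta (p ^ Suc k) powi (b * v)) = 0"
proof -
  let ?z = "zeta (p ^ Suc k)"
  define f where "f = (\<Sum>v<n. monom (int (g (int v))) v)"
  have f: "eval_int f (?z powi c) = (\<Sum>v\<in>{0..<int n}. of_nat (g v) * ?z powi (c * v))" for c
    by (simp add: f_def sum_int_interval power_int_mult)
  have p0: "p > 0"
    using p prime_gt_0_nat by blast
  have root: "(?z powi c) ^ (p ^ Suc k) = 1" "(?z powi c) ^ (p ^ k) \<noteq> 1" if "\<not> int p dvd c" for c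
  proof -
    have pow: "(?z powi c) ^ m = ?z powi (c * int m)" for m
      by (simp add: power_int_mult)
    have "?z powi (c * int (p ^ Suc k)) = 1"
      using p0 by (subst zeta_powi_eq_1_iff) auto
    then show "(?z powi c) ^ (p ^ Suc k) = 1"
      by (simp only: pow)
    have "\<not> int (p ^ Suc k) dvd c * int (p ^ k)"
      using that p0 by simp
    then have "?z powi (c * int (p ^ k)) \<noteq> 1"
      using p0 by (subst zeta_powi_eq_1_iff) auto
    then show "(?z powi c) ^ (p ^ k) \<noteq> 1"
      unfolding pow .
  qed
  show ?thesis
    using eval_int_eq_0_conjugate[OF p root[OF ab(1)] root[OF ab(2)], of f] assms(4) unfolding f
    by blast
qed

section \<open>Primitivity and differences prime to p\<close>

text \<open>The subgroup is that of the multiples of \<open>d\<close>, which misses 1 since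
  \<open>d > 1\<close>; any element of \<open>S\<close> represents the coset.\<close>

lemma in_proper_coset_if_dvd_diff:
  assumes S: "S \<subseteq> {0..<int n}" "S \<noteq> {}" and d: "d dvd n" "d > 1" and n: "n > 0"
    and diff: "\<And>x y. x \<in> S \<Longrightarrow> y \<in> S \<Longrightarrow> int d dvd x - y"
  shows "in_proper_coset n S"
proof -
  let ?G = "integer_mod_group n"
  define H where "H = {x \<in> {0..<int n}. int d dvd x}"
  have C: "carrier ?G = {0..<int n}"
    using n by (simp add: carrier_integer_mod_group)
  have dn: "int d dvd int n"
    using d by simp
  have sub: "subgroup H ?G"
  proof (rule group.subgroupI)
    show "group ?G"
      by simp
    show "H \<subseteq> carrier ?G"
      by (auto simp: H_def C)
    have "0 \<in> H"
      using n by (simp add: H_def)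
    then show "H \<noteq> {}"
      by auto
    show "inv\<^bsub>?G\<^esub> x \<in> H" if "x \<in> H" for x
      using that n dn C by (auto simp: H_def dvd_mod)
    show "x \<otimes>\<^bsub>?G\<^esub> y \<in> H" if "x \<in> H" "y \<in> H" for x y
      using that n dn by (auto simp: H_def dvd_mod)
  qed
  have "d \<le> n"
    using d n by (simp add: dvd_imp_le)
  then have "1 \<in> carrier ?G" "1 \<notin> H"
    using d by (auto simp: C H_def)
  then have "H \<noteq> carrier ?G"
    by blast
  obtain a where a: "a \<in> S"
    using S by blast
  have "S \<subseteq> H #>\<^bsub>?G\<^esub> a"
  proof
    fix x assume x: "x \<in> S"
    let ?h = "(x - a) mod int n"
    have "?h \<in> H"
      using diff[OF x a] dn n by (auto simp: H_def dvd_mod)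
    moreover have "(?h + a) mod int n = x"
      using x S by (auto simp: mod_simps)
    ultimately show "x \<in> H #>\<^bsub>?G\<^esub> a"
      by (force simp: r_coset_def)
  qed
  moreover have "a \<in> carrier ?G"
    using a S C by blast
  ultimately show ?thesis
    using sub \<open>H \<noteq> carrier ?G\<close> unfolding in_proper_coset_def by blast
qed

lemma not_in_proper_coset_weight_enumerator:
  assumes S: "S \<subseteq> {0..<int n}" "S \<noteq> {}" and d: "d dvd n" "d > 1" and n: "n > 0"
    and nc: "\<not> in_proper_coset n S"
  obtains v where "v \<in> {0..<int n}" "\<not> int d dvd v" "weight_enumerator n S v \<noteq> 0"
proof -
  obtain x y where xy: "x \<in> S" "y \<in> S" "\<not> int d dvd x - y"
    using in_proper_coset_if_dvd_diff[OF S d n] nc by blast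
  let ?v = "(x - y) mod int n"
  have "finite {(v, w) \<in> S \<times> S. (v - w) mod int n = ?v}"
  proof (rule finite_subset)
    show "finite (S \<times> S)"
      using S(1) finite_subset by blast
  qed auto
  moreover have "(x, y) \<in> {(v, w) \<in> S \<times> S. (v - w) mod int n = ?v}"
    using xy by simp
  ultimately have "weight_enumerator n S ?v \<noteq> 0"
    unfolding weight_enumerator_def card_eq_0_iff by blast
  \<comment> \<open>Since \<open>d\<close> divides \<open>n\<close>, reduction modulo
    \<open>n\<close> preserves divisibility by \<open>d\<close>.\<close>
  moreover have "\<not> int d dvd ?v"
    using xy d by (simp add: dvd_mod_iff)
  ultimately show thesis
    using that[of ?v] n by simp
qed

section \<open>Counting differences\<close>

lemma card_not_dvd_prime_power:
  assumes "p > 0"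
  shows "card {v \<in> {0..<int (p ^ Suc k)}. \<not> int p dvd v} = p ^ Suc k - p ^ k"
proof -
  let ?C = "{0..<int (p ^ Suc k)}" and ?D = "(\<lambda>v. int p * v) ` {0..<int (p ^ k)}"
  have "{v \<in> ?C. \<not> int p dvd v} = ?C - ?D"
    using assms by (auto simp: zero_le_mult_iff image_iff elim: dvdE)
  moreover have "?D \<subseteq> ?C"
    using assms by auto
  moreover have "card ?D = p ^ k"
    using assms by (subst card_image) (auto simp: inj_on_def simp del: of_nat_power)
  ultimately show ?thesis
    by (simp add: card_Diff_subset del: of_nat_power power_Suc)
qed

text \<open>The squared cardinality is the sum of all weights. The weight at 0 is
  \<open>card S > 0\<close>, each residue prime to \<open>p\<close> adds at least 1, and
  \<open>p \<ge> 2\<close> makes the number of these residues at least \<open>p ^ k\<close>.\<close>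

lemma prime_power_less_card_square:
  assumes p: "prime p" and S: "S \<subseteq> {0..<int (p ^ Suc k)}" "S \<noteq> {}"
    and pos: "\<And>v. v \<in> {0..<int (p ^ Suc k)} \<Longrightarrow> \<not> int p dvd v \<Longrightarrow> weight_enumerator (p ^ Suc k) S v \<noteq> 0"
  shows "p ^ k < (card S)\<^sup>2"
proof -
  let ?n = "p ^ Suc k"
  let ?U = "{v \<in> {0..<int ?n}. \<not> int p dvd v}"
  have p2: "p \<ge> 2"
    using p prime_ge_2_nat by blast
  then have n: "?n > 0"
    by simp
  have fin: "finite S"
    using S finite_subset by blast
  have "2 * p ^ k \<le> p ^ Suc k"
    using p2 by simp
  then have "p ^ k < card S + (p ^ Suc k - p ^ k)"
    using fin S card_gt_0_iff[of S] by linarith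
  also have "\<dots> = weight_enumerator ?n S 0 + (\<Sum>v\<in>?U. 1)"
    using card_not_dvd_prime_power[of p k] p2 S by (simp add: weight_enumerator_0 del: power_Suc)
  also have "\<dots> \<le> weight_enumerator ?n S 0 + (\<Sum>v\<in>?U. weight_enumerator ?n S v)"
    using pos by (intro add_left_mono sum_mono) (simp add: Suc_le_eq del: power_Suc)
  also have "\<dots> = (\<Sum>v\<in>insert 0 ?U. weight_enumerator ?n S v)"
  proof (subst sum.insert)
    show "finite ?U"
      by (rule finite_subset[of _ "{0..<int ?n}"]) auto
  qed auto
  also have "\<dots> \<le> (\<Sum>v\<in>{0..<int ?n}. weight_enumerator ?n S v)"
    using n by (intro sum_mono2) auto
  also have "\<dots> = (card S)\<^sup>2"
    by (rule sum_weight_enumerator[OF n fin])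
  finally show ?thesis .
qed

theorem theorem4p1:
  fixes p k :: nat and S :: "int set"
  assumes "prime p" and "k \<ge> 1" and "primitive_formal_dual (p ^ k) S"
  shows "even k \<and> card S = p ^ (k div 2)"
proof -
  obtain l where k: "k = Suc l"
    using \<open>k \<ge> 1\<close> by (cases k) auto
  define n where "n = p ^ Suc l"
  obtain T where fd: "formally_dual n S T" and nc: "\<not> in_proper_coset n S" "\<not> in_proper_coset n T"
    using assms(3) by (auto simp: primitive_formal_dual_def primitive_pair_def n_def k)
  have p1: "p > 1"
    using \<open>prime p\<close> prime_gt_1_nat by blast
  then have n: "n > 0" and pn: "p dvd n"
    by (simp_all add: n_def)
  note sub = formally_dual_subset[OF fd n]
  let ?c = "of_nat (card S) ^ 2 / of_nat (card T) :: complex"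
  have "card S > 0" "card T > 0"
    using formally_dual_card[OF fd n] n by (metis gr0I mult_is_0)+
  then have c: "?c \<noteq> 0"
    by simp
  \<comment> \<open>Up to the nonzero factor \<open>?c\<close>, the weight at \<open>y\<close> is a
    character sum of the weights of \<open>S\<close>. A zero at one \<open>y\<close> prime to
    \<open>p\<close> would spread to all of them, but primitivity supplies a nonzero weight at some
    \<open>y'\<close>.\<close>
  have T: "weight_enumerator n T y \<noteq> 0" if y: "y \<in> {0..<int n}" "\<not> int p dvd y" for y
  proof
    obtain y' where y': "y' \<in> {0..<int n}" "\<not> int p dvd y'" "weight_enumerator n T y' \<noteq> 0"
      using not_in_proper_coset_weight_enumerator[OF sub(2,4) pn p1 n nc(2)] .
    have dual: "?c * of_nat (weight_enumerator n T y)
        = (\<Sum>v\<in>{0..<int n}. of_nat (weight_enumerator n S v) * zeta (p ^ Suc l) powi (y * v))"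
      if "y \<in> {0..<int n}" for y
      using fd n that unfolding n_def[symmetric]
      by (simp add: formally_dual_def carrier_integer_mod_group mult.commute)
    assume "weight_enumerator n T y = 0"
    then have "?c * of_nat (weight_enumerator n T y') = 0"
      using zeta_sum_eq_0_conjugate[OF \<open>prime p\<close> y(2) y'(2)] dual[OF y(1)] dual[OF y'(1)] by simp
    with c y' show False
      by simp
  qed
  \<comment> \<open>The same argument through the inversion formula, hence with exponents
    \<open>- w\<close> and \<open>- w'\<close>.\<close>
  have S: "weight_enumerator n S w \<noteq> 0" if w: "w \<in> {0..<int n}" "\<not> int p dvd w" for w
  proof
    obtain w' where w': "w' \<in> {0..<int n}" "\<not> int p dvd w'" "weight_enumerator n S w' \<noteq> 0"
      using not_in_proper_coset_weight_enumerator[OF sub(1,3) pn p1 n nc(1)] .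
    let ?F = "\<lambda>w. \<Sum>y\<in>{0..<int n}. of_nat (weight_enumerator n T y) * zeta (p ^ Suc l) powi (- w * y)"
    assume "weight_enumerator n S w = 0"
    then have "?F w = 0"
      using formally_dual_inversion[OF fd n w(1)] c by (simp add: n_def del: power_Suc)
    then have "?F w' = 0"
      using zeta_sum_eq_0_conjugate[OF \<open>prime p\<close>, of "- w" "- w'"] w w' by simp
    then show False
      using formally_dual_inversion[OF fd n w'(1)] w' n by (simp add: n_def del: power_Suc)
  qed
  \<comment> \<open>The strict bound \<open>p ^ l < p ^ (2 * i)\<close> with
    \<open>k = Suc l\<close> is what yields \<open>k \<le> 2 * i\<close> without losing 1.\<close>
  have ge: "k \<le> 2 * i" if "X \<subseteq> {0..<int n}" "X \<noteq> {}" "card X = p ^ i"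
    "\<And>v. v \<in> {0..<int n} \<Longrightarrow> \<not> int p dvd v \<Longrightarrow> weight_enumerator n X v \<noteq> 0" for X i
  proof -
    have "p ^ l < (p ^ i)\<^sup>2"
      using prime_power_less_card_square[OF \<open>prime p\<close>, of X l] that unfolding n_def by simp
    then have "p ^ l < p ^ (2 * i)"
      by (simp add: power_mult[symmetric] mult.commute)
    then show ?thesis
      using p1 by (simp add: k)
  qed
  have card: "card S * card T = p ^ k"
    using formally_dual_card[OF fd n] by (simp add: n_def k)
  then obtain i j where ij: "card S = p ^ i" "card T = p ^ j"
    using divides_primepow_nat[OF \<open>prime p\<close>, of _ k] by (metis dvd_triv_left dvd_triv_right)
  have "i + j = k"
    using card p1 by (simp add: ij flip: power_add)
  \<comment> \<open>Together with \<open>i + j = k\<close>, these two bounds leave only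
    \<open>i = j\<close>.\<close>
  moreover have "k \<le> 2 * i" "k \<le> 2 * j"
    using ge[OF sub(1,3) ij(1)] ge[OF sub(2,4) ij(2)] S T by blast+
  ultimately have "k = 2 * i"
    by simp
  with ij show ?thesis
    by simp
qed

end
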